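(* Let $0<\kappa<1$, and let $\phi:\mathbb{R}\to\mathbb{R}$ be the function defined in the context (for the modulus $\kappa$). Then the function $\sin\phi:\mathbb{R}\to\mathbb{R}$ lacks a meromorphic extension to $\mathbb{C}$; that is, there is no meromorphic function on $\mathbb{C}$ whose restriction to $\mathbb{R}$ is $\sin\phi$.
   Context: $F(a,b;c;z)={}_2F_1(a,b;c;z)$ is the Gauss hypergeometric function. Fix the modulus $\kappa\in(0,1)$. The map $\mathbb{R}\to\mathbb{R}$, $T\mapsto\int_0^T F(\tfrac14,\tfrac34;\tfrac12;\kappa^2\sin^2 t)\,dt$, is an odd strictly increasing bijection; $\phi:\mathbb{R}\to\mathbb{R}$ denotes its inverse. *)

theory Defs
  imports "HOL-Complex_Analysis.Complex_Analysis"
begin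

text \<open>The defining power series of the Gauss hypergeometric function. It is only meaningful for
  \<open>norm z < 1\<close>, which covers the arguments used below.\<close>

definition hypergeo_2F1 ::
    "'a \<Rightarrow> 'a \<Rightarrow> 'a \<Rightarrow> 'a \<Rightarrow> 'a :: {banach, real_normed_field}" where
  "hypergeo_2F1 a b c z = eval_fps (fps_hypergeo [a, b] [c] 1) z"

text \<open>The interval integral is oriented, so \<open>T\<close> may be negative.\<close>

definition hyp_int :: "real \<Rightarrow> real \<Rightarrow> real" where
  "hyp_int \<kappa> T = (LBINT t=0..T. hypergeo_2F1 (1/4) (3/4) (1/2) (\<kappa>\<^sup>2 * (sin t)\<^sup>2))"

text \<open>\<open>hyp_int \<kappa>\<close> is a bijection for \<open>0 < \<kappa> < 1\<close> (\<open>bij_hyp_int\<close> below), so \<open>inv\<close> is the genuine inverse.\<close>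

definition phi :: "real \<Rightarrow> real \<Rightarrow> real" where
  "phi \<kappa> = inv (hyp_int \<kappa>)"

abbreviation "hcoeff \<equiv> fps_nth (fps_hypergeo [1/4, 3/4] [1/2] (1::real))"

lemma hypergeo_coeff_bounds:
  "0 < hcoeff n \<and> hcoeff n \<le> 1"
proof (induction n)
  case 0
  then show ?case by simp
next
  case (Suc n)
  have *: "hcoeff (Suc n) =
     (((1/4 + real n) * (3/4 + real n)) / ((1 + real n) * (1/2 + real n))) * hcoeff n"
    by (subst fps_hypergeo_rec) (simp add: mult_ac)
  have "(1/4 + real n) * (3/4 + real n) \<le> (1 + real n) * (1/2 + real n)"
    by (simp add: algebra_simps)
  hence "((1/4 + real n) * (3/4 + real n)) / ((1 + real n) * (1/2 + real n)) \<le> 1"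
    by (subst divide_le_eq_1_pos) (auto intro!: mult_pos_pos)
  moreover have "((1/4 + real n) * (3/4 + real n)) / ((1 + real n) * (1/2 + real n)) > 0"
    by (auto intro!: divide_pos_pos mult_pos_pos add_pos_nonneg)
  ultimately show ?case unfolding * using Suc
    by (metis mult_le_one less_imp_le mult_pos_pos)
qed

lemma hypergeo_conv_radius: "fps_conv_radius (fps_hypergeo [1/4, 3/4] [1/2] (1::real)) \<ge> 1"
proof -
  have "conv_radius (fps_nth (fps_hypergeo [1/4, 3/4] [1/2] (1::real))) \<ge> 1"
  proof (rule conv_radius_geI_ex)
    fix r :: real assume r: "0 < r" "ereal r < 1"
    have "summable (\<lambda>n. hcoeff n * r ^ n)"
    proof (rule summable_comparison_test')
      show "summable (\<lambda>n. r ^ n)" using r by (auto simp: summable_geometric_iff one_ereal_def)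
      show "norm (hcoeff n * r ^ n) \<le> r ^ n" if "n \<ge> 0" for n
        using hypergeo_coeff_bounds[of n] r
        by (simp add: abs_mult mult_left_le_one_le del: fps_hypergeo_nth)
    qed
    thus "\<exists>z. norm z = r \<and> summable (\<lambda>n. hcoeff n * z ^ n)"
      using r by (intro exI[of _ r]) (simp del: fps_hypergeo_nth)
  qed
  thus ?thesis by (simp add: fps_conv_radius_def)
qed

lemma hypergeo_conv_radius_gt:
  "z < 1 \<Longrightarrow> ereal z < fps_conv_radius (fps_hypergeo [1/4, 3/4] [1/2] (1::real))"
  using less_le_trans[OF _ hypergeo_conv_radius, of "ereal z"] by (simp add: one_ereal_def)

lemma hypergeo_2F1_ge_1:
  assumes "0 \<le> z" "z < (1::real)"
  shows "hypergeo_2F1 (1/4) (3/4) (1/2) z \<ge> 1"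
proof -
  let ?c = "fps_nth (fps_hypergeo [1/4, 3/4] [1/2] (1::real))"
  have "summable (\<lambda>n. ?c n * z ^ n)"
    using assms hypergeo_conv_radius_gt
    by (intro summable_in_conv_radius) (auto simp flip: fps_conv_radius_def simp del: fps_hypergeo_nth)
  moreover have nonneg: "?c n * z ^ n \<ge> 0" for n
    using hypergeo_coeff_bounds[of n] assms by (simp add: less_imp_le del: fps_hypergeo_nth)
  ultimately have "sum (\<lambda>n. ?c n * z ^ n) {..<1} \<le> (\<Sum>n. ?c n * z ^ n)"
    using nonneg by (intro sum_le_suminf) (auto simp del: fps_hypergeo_nth)
  thus ?thesis by (simp add: hypergeo_2F1_def eval_fps_def)
qed

lemma hyp_arg:
  assumes "0 < \<kappa>" "\<kappa> < (1::real)"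
  shows "\<kappa>\<^sup>2 * (sin t)\<^sup>2 \<ge> 0" "\<kappa>\<^sup>2 * (sin t)\<^sup>2 < 1"
proof -
  have "(sin t)\<^sup>2 \<le> 1" by (simp add: abs_square_le_1)
  hence "\<kappa>\<^sup>2 * (sin t)\<^sup>2 \<le> \<kappa>\<^sup>2" by (simp add: mult_left_le)
  also have "\<kappa>\<^sup>2 < 1" using assms by (simp add: power_less_one_iff)
  finally show "\<kappa>\<^sup>2 * (sin t)\<^sup>2 < 1" .
qed auto

lemma hyp_int_deriv:
  assumes "0 < \<kappa>" "\<kappa> < 1"
  shows "(hyp_int \<kappa> has_real_derivative
           hypergeo_2F1 (1/4) (3/4) (1/2) (\<kappa>\<^sup>2 * (sin T)\<^sup>2)) (at T)"
proof -
  define f where "f = (\<lambda>t. hypergeo_2F1 (1/4) (3/4) (1/2) (\<kappa>\<^sup>2 * (sin t)\<^sup>2))"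
  define N where "N = \<bar>T\<bar> + 1"
  have "continuous_on UNIV f"
    unfolding f_def hypergeo_2F1_def
  proof (intro continuous_intros)
    show "range (\<lambda>t. \<kappa>\<^sup>2 * (sin t)\<^sup>2) \<subseteq> eball 0 (fps_conv_radius (fps_hypergeo [1/4, 3/4] [1/2] (1::real)))"
      using hyp_arg[OF assms] hypergeo_conv_radius_gt by (auto simp: abs_mult)
  qed
  hence c: "continuous_on {-N..N} f" by (rule continuous_on_subset) auto
  have "((\<lambda>u. LBINT y=0..u. f y) has_vector_derivative (f T)) (at T within {-N..N})"
    using interval_integral_FTC2[of "-N" 0 N f T] c by (auto simp: N_def zero_ereal_def)
  hence "((\<lambda>u. LBINT y=0..u. f y) has_vector_derivative (f T)) (at T)"
    by (subst (asm) at_within_interior) (auto simp: N_def)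
  thus ?thesis
    by (simp add: f_def hyp_int_def[abs_def] has_real_derivative_iff_has_vector_derivative)
qed

lemma hyp_int_growth:
  assumes "0 < \<kappa>" "\<kappa> < 1" "S \<le> T"
  shows "hyp_int \<kappa> T - hyp_int \<kappa> S \<ge> T - S"
proof -
  have "hyp_int \<kappa> S - S \<le> hyp_int \<kappa> T - T"
    using assms hypergeo_2F1_ge_1[OF hyp_arg[OF assms(1,2)]]
    by (intro DERIV_nonneg_imp_nondecreasing[OF assms(3)])
       (auto intro!: exI derivative_eq_intros hyp_int_deriv)
  thus ?thesis by simp
qed

lemma bij_hyp_int:
  assumes "0 < \<kappa>" "\<kappa> < 1"
  shows "bij (hyp_int \<kappa>)"
proof (rule bijI)
  show "inj (hyp_int \<kappa>)"
  proof (rule linorder_injI)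
    fix x y :: real assume "x < y"
    thus "hyp_int \<kappa> x \<noteq> hyp_int \<kappa> y"
      using hyp_int_growth[OF assms, of x y] by auto
  qed
  have z: "hyp_int \<kappa> 0 = 0" by (simp add: hyp_int_def flip: zero_ereal_def)
  show "surj (hyp_int \<kappa>)"
  unfolding surj_def
  proof safe
    fix y :: real
    have "\<exists>x\<ge>-\<bar>y\<bar>. x \<le> \<bar>y\<bar> \<and> hyp_int \<kappa> x = y"
    proof (rule IVT')
      show "continuous_on {-\<bar>y\<bar>..\<bar>y\<bar>} (hyp_int \<kappa>)"
        using hyp_int_deriv[OF assms] by (intro DERIV_continuous_on) (blast intro: DERIV_subset)
    qed (use hyp_int_growth[OF assms, of 0 "\<bar>y\<bar>"] hyp_int_growth[OF assms, of "-\<bar>y\<bar>" 0] z in auto)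
    thus "\<exists>x. y = hyp_int \<kappa> x" by blast
  qed
qed
end

theory Submission
  imports Defs
begin

text \<open>
  Write \<open>s = sin \<circ> phi \<kappa>\<close>. The even part of the binomial series of \<open>(1 - x) powr (-1/2)\<close> gives
  \<open>F(1/4, 3/4; 1/2; x\<^sup>2) = ((1 - x) powr (-1/2) + (1 + x) powr (-1/2)) / 2\<close>, so the defining
  integral becomes an algebraic differential equation on the real line: with
  \<open>v = 1 + sqrt (1 - \<kappa>\<^sup>2 s\<^sup>2)\<close>,
  \<open>v s'\<^sup>2 = 2 (1 - s\<^sup>2) (1 - \<kappa>\<^sup>2 s\<^sup>2)\<close> and \<open>\<kappa>\<^sup>2 s\<^sup>2 = v (2 - v)\<close>.

  The first equation exhibits \<open>v\<close> as a rational expression in \<open>s\<close> and \<open>s'\<close>. Hence, if \<open>s\<close> extends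
  to a meromorphic function on the plane, so does \<open>v\<close>, and both equations persist. Eliminating
  \<open>s\<close> gives \<open>v'\<^sup>2 = 2 (2 - v) (v\<^sup>2 - 2 v + \<kappa>\<^sup>2)\<close>, the equation of an elliptic function.
  The obstruction is at the zeros of \<open>v\<close>: there \<open>v'\<^sup>2 = 4 \<kappa>\<^sup>2\<close>, so such a zero is simple, while
  \<open>v (2 - v)\<close> is the square of the meromorphic function \<open>\<kappa> s\<close> and can only have zeros of even
  order. Thus \<open>v\<close> omits the value \<open>0\<close> (\<open>v_nonzero\<close>).

  An elliptic function takes every value, but this can be seen here without any theory of elliptic
  functions. If \<open>v\<close> omits \<open>0\<close>, then \<open>w = 1 / v\<close> is entire and satisfies
  \<open>w'\<^sup>2 = 2 w (2 w - 1) (\<kappa>\<^sup>2 w\<^sup>2 - 2 w + 1)\<close>. The right-hand side is a quartic in \<open>w\<close>, so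
  \<open>w'\<close> has at least the size of a multiple of \<open>w\<^sup>2\<close> wherever \<open>w\<close> is large, and a function with
  this property blows up in finite distance unless it is bounded
  (\<open>entire_deriv_ge_square_imp_constant\<close>). So \<open>w\<close>, \<open>v\<close> and \<open>s\<^sup>2\<close> are constant, which is absurd
  because \<open>s\<close> vanishes at \<open>0\<close> but not at nearby real points.
\<close>

section \<open>The hypergeometric function in closed form\<close>

text \<open>
  By the duplication formula, \<open>(1/4)\<^sub>n (3/4)\<^sub>n\<close> and \<open>(1/2)\<^sub>n n!\<close> are \<open>(1/2)\<^sub>2\<^sub>n\<close> and \<open>(2n)!\<close> up to the
  same power of \<open>4\<close>. This identifies the hypergeometric coefficients with the even coefficients of
  a binomial series.
\<close>

lemma hcoeff_eq_gbinomial: "hcoeff n = ((-1/2) gchoose (2 * n))"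
proof -
  have p: "pochhammer (1/2::real) (2 * n) = 2 ^ (2 * n) * pochhammer (1/4) n * pochhammer (3/4) n"
    using pochhammer_double[of "1/4::real" n] by simp
  have f: "(fact (2 * n) :: real) = 2 ^ (2 * n) * pochhammer (1/2) n * fact n"
    by (rule fact_double)
  have "hcoeff n = pochhammer (1/4) n * pochhammer (3/4) n / (pochhammer (1/2) n * fact n)"
    by simp
  also have "\<dots> = pochhammer (1/2) (2 * n) / fact (2 * n)"
    unfolding p f by simp
  also have "\<dots> = ((-1/2) gchoose (2 * n))"
    by (simp add: gbinomial_pochhammer)
  finally show ?thesis .
qed

lemma hypergeo_quarter_sq:
  fixes x :: real
  assumes x: "\<bar>x\<bar> < 1"
  shows "hypergeo_2F1 (1/4) (3/4) (1/2) (x\<^sup>2) = ((1 - x) powr (-1/2) + (1 + x) powr (-1/2)) / 2"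
proof -
  let ?a = "\<lambda>n. ((-1/2) gchoose n) * x ^ n"
  have 1: "?a sums (1 + x) powr (-1/2)"
    using gen_binomial_real[of x "-1/2"] x by simp
  have 2: "(\<lambda>n. ((-1/2) gchoose n) * (-x) ^ n) sums (1 - x) powr (-1/2)"
    using gen_binomial_real[of "-x" "-1/2"] x by simp
  have "(\<lambda>n. (?a n + ((-1/2) gchoose n) * (-x) ^ n) / 2) sums
          (((1 + x) powr (-1/2) + (1 - x) powr (-1/2)) / 2)"
    by (intro sums_divide sums_add 1 2)
  also have "(\<lambda>n. (?a n + ((-1/2) gchoose n) * (-x) ^ n) / 2) = (\<lambda>n. if even n then ?a n else 0)"
    by (auto simp: fun_eq_iff)
  finally have "(\<lambda>n. if even n then ?a n else 0) sums (((1 + x) powr (-1/2) + (1 - x) powr (-1/2)) / 2)" .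
  hence "(\<lambda>n. ?a (2 * n)) sums (((1 + x) powr (-1/2) + (1 - x) powr (-1/2)) / 2)"
    by (subst (asm) sums_mono_reindex[of "\<lambda>n. 2 * n", symmetric])
       (auto simp: strict_mono_def elim!: evenE)
  hence "(\<lambda>n. hcoeff n * (x\<^sup>2) ^ n) sums (((1 + x) powr (-1/2) + (1 - x) powr (-1/2)) / 2)"
    by (simp only: hcoeff_eq_gbinomial power_mult)
  thus ?thesis unfolding hypergeo_2F1_def eval_fps_def
    by (simp only: sums_iff add.commute)
qed

text \<open>
  The form in which the differential equation of \<open>sin \<circ> phi \<kappa>\<close> uses the closed form: with
  \<open>c = sqrt (1 - x\<^sup>2)\<close> it says \<open>F\<^sup>2 = (1 + c) / (2 c\<^sup>2)\<close>, and only one square root is left.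
\<close>

lemma hypergeo_quarter_square_eq:
  fixes x :: real
  assumes x: "\<bar>x\<bar> < 1"
  shows "2 * (1 - x\<^sup>2) * (hypergeo_2F1 (1/4) (3/4) (1/2) (x\<^sup>2))\<^sup>2 = 1 + sqrt (1 - x\<^sup>2)"
proof -
  define p q where "p = sqrt (1 - x)" "q = sqrt (1 + x)"
  have pq: "p > 0" "q > 0" "p\<^sup>2 = 1 - x" "q\<^sup>2 = 1 + x" using x by (auto simp: p_q_def)
  have pw: "(1 - x) powr (-1/2) = 1 / p" "(1 + x) powr (-1/2) = 1 / q"
    using x by (auto simp: p_q_def powr_minus powr_half_sqrt field_simps)
  have "1 - x\<^sup>2 = p\<^sup>2 * q\<^sup>2" unfolding pq by (simp add: algebra_simps power2_eq_square)
  hence c: "1 - x\<^sup>2 = (p * q)\<^sup>2" by (simp add: power_mult_distrib)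
  have "2 * (1 - x\<^sup>2) * ((1 / p + 1 / q) / 2)\<^sup>2 = (p\<^sup>2 + q\<^sup>2) / 2 + p * q"
    unfolding c using pq(1,2) by (simp add: field_simps power2_eq_square)
  also have "\<dots> = 1 + sqrt (1 - x\<^sup>2)"
    unfolding c using pq by simp
  finally show ?thesis unfolding hypergeo_quarter_sq[OF x] pw .
qed

section \<open>The real differential equation\<close>

context
  fixes \<kappa> :: real
  assumes \<kappa>: "0 < \<kappa>" "\<kappa> < 1"
begin

lemma hyp_int_phi: "hyp_int \<kappa> (phi \<kappa> x) = x"
  using bij_hyp_int[OF \<kappa>] unfolding phi_def by (simp add: bij_is_surj surj_f_inv_f)

text \<open>The integrand is at least \<open>1\<close>, so \<open>hyp_int \<kappa>\<close> expands distances.\<close>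

lemma phi_Lipschitz: "\<bar>phi \<kappa> x - phi \<kappa> y\<bar> \<le> \<bar>x - y\<bar>"
proof (cases "phi \<kappa> x \<le> phi \<kappa> y")
  case True
  thus ?thesis using hyp_int_growth[OF \<kappa> True] by (simp add: hyp_int_phi)
next
  case False
  hence "phi \<kappa> y \<le> phi \<kappa> x" by simp
  from hyp_int_growth[OF \<kappa> this] this show ?thesis by (simp add: hyp_int_phi)
qed

lemma phi_0: "phi \<kappa> 0 = 0"
proof -
  have "hyp_int \<kappa> 0 = 0" by (simp add: hyp_int_def flip: zero_ereal_def)
  thus ?thesis using bij_hyp_int[OF \<kappa>] unfolding phi_def by (metis bij_is_inj inv_f_f)
qed

lemma phi_eq_0_iff: "phi \<kappa> x = 0 \<longleftrightarrow> x = 0"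
  using hyp_int_phi[of x] hyp_int_phi[of 0] phi_0 by metis

lemma isCont_phi: "isCont (phi \<kappa>) x"
  unfolding continuous_at_eps_delta
  using phi_Lipschitz by (metis dist_real_def le_less_trans)

lemma DERIV_phi:
  "(phi \<kappa> has_real_derivative 1 / hypergeo_2F1 (1/4) (3/4) (1/2) (\<kappa>\<^sup>2 * (sin (phi \<kappa> x))\<^sup>2)) (at x)"
proof -
  let ?F = "hypergeo_2F1 (1/4) (3/4) (1/2) (\<kappa>\<^sup>2 * (sin (phi \<kappa> x))\<^sup>2)"
  have "?F \<ge> 1" by (intro hypergeo_2F1_ge_1 hyp_arg \<kappa>)
  have "(phi \<kappa> has_real_derivative inverse ?F) (at x)"
    by (rule DERIV_inverse_function[where f = "hyp_int \<kappa>" and a = "x - 1" and b = "x + 1"])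
       (use \<open>?F \<ge> 1\<close> in \<open>auto intro!: hyp_int_deriv[OF \<kappa>] isCont_phi simp: hyp_int_phi\<close>)
  thus ?thesis by (simp add: inverse_eq_divide)
qed

lemma DERIV_sin_phi:
  obtains D where "((\<lambda>x. sin (phi \<kappa> x)) has_real_derivative D) (at x)"
    and "(1 + sqrt (1 - (\<kappa> * sin (phi \<kappa> x))\<^sup>2)) * D\<^sup>2 = 
           2 * (1 - (sin (phi \<kappa> x))\<^sup>2) * (1 - (\<kappa> * sin (phi \<kappa> x))\<^sup>2)"
proof -
  define y where "y = phi \<kappa> x"
  define F where "F = hypergeo_2F1 (1/4) (3/4) (1/2) ((\<kappa> * sin y)\<^sup>2)"
  have lt: "\<bar>\<kappa> * sin y\<bar> < 1"
    using hyp_arg(2)[OF \<kappa>, of y] by (simp add: abs_square_less_1 flip: power_mult_distrib)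
  have F: "F \<ge> 1" unfolding F_def
    using hyp_arg[OF \<kappa>, of y] by (intro hypergeo_2F1_ge_1) (simp_all add: power_mult_distrib)
  have "((\<lambda>x. sin (phi \<kappa> x)) has_real_derivative cos y * (1 / F)) (at x)"
    unfolding y_def F_def power_mult_distrib
    by (rule DERIV_chain2[OF DERIV_sin DERIV_phi])
  moreover have "(1 + sqrt (1 - (\<kappa> * sin y)\<^sup>2)) * (cos y * (1 / F))\<^sup>2 
                   = 2 * (1 - (sin y)\<^sup>2) * (1 - (\<kappa> * sin y)\<^sup>2)"
    unfolding hypergeo_quarter_square_eq[OF lt, symmetric] F_def[symmetric]
    using F by (simp add: cos_squared_eq field_simps power_mult_distrib)
  ultimately show ?thesis using that unfolding y_def by blast
qed

end

section \<open>Entire functions whose derivative dominates their square\<close>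

text \<open>
  Cauchy's inequality forbids \<open>\<bar>w'\<bar> \<ge> a \<bar>w\<bar>\<^sup>2\<close> at a point if \<open>\<bar>w\<bar>\<close> at most doubles on a disc around
  it of radius more than \<open>2 / (a \<bar>w\<bar>)\<close>. Such a point is found by maximising
  \<open>(\<rho> - dist z0 z) * \<bar>w z\<bar>\<close> over a disc of radius \<open>\<rho>\<close> around a point \<open>z0\<close> where \<open>w\<close> is large: at a
  maximum \<open>p\<close> the function at most doubles on the disc that reaches half way from \<open>p\<close> to the
  boundary. So \<open>w\<close> is bounded, and Liouville's theorem applies.
\<close>

lemma entire_deriv_ge_square_imp_constant:
  fixes w :: "complex \<Rightarrow> complex"
  assumes hol: "w holomorphic_on UNIV" and a: "a > 0"
    and grow: "\<And>z. norm (w z) > R \<Longrightarrow> norm (deriv w z) \<ge> a * (norm (w z))\<^sup>2"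
  shows "w constant_on UNIV"
proof -
  have le: "norm (w z0) \<le> max R 0" for z0
  proof (rule ccontr)
    assume "\<not> norm (w z0) \<le> max R 0"
    hence big: "norm (w z0) > R" "norm (w z0) > 0" by auto
    \<comment> \<open>The estimate at the maximum will give \<open>a * \<rho> * norm (w z0) \<le> 4\<close>; any constant above \<open>4\<close>
      makes this a contradiction.\<close>
    define \<rho> where "\<rho> = 5 / (a * norm (w z0))"
    have \<rho>: "\<rho> > 0" using a big by (simp add: \<rho>_def)
    define h where "h = (\<lambda>z. (\<rho> - dist z0 z) * norm (w z))"
    have cont: "continuous_on S w" for S
      using hol holomorphic_on_imp_continuous_on holomorphic_on_subset by blast
    have "continuous_on (cball z0 \<rho>) h"
      unfolding h_def by (intro continuous_intros cont)
    then obtain p where p: "p \<in> cball z0 \<rho>" "\<And>z. z \<in> cball z0 \<rho> \<Longrightarrow> h z \<le> h p"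
      using continuous_attains_sup[of "cball z0 \<rho>" h] \<rho> by auto
    have h0: "\<rho> * norm (w z0) \<le> h p"
      using p(2)[of z0] \<rho> by (simp add: h_def)
    define d where "d = (\<rho> - dist z0 p) / 2"
    have hp: "h p = 2 * d * norm (w p)" by (simp add: h_def d_def)
    have d: "d > 0"
    proof -
      have "d \<ge> 0" using p(1) by (simp add: d_def)
      moreover have "d \<noteq> 0"
        using h0 hp \<rho> big by (auto simp: mult_le_0_iff)
      ultimately show ?thesis by simp
    qed
    have "h p \<le> \<rho> * norm (w p)" by (auto simp: h_def intro!: mult_right_mono)
    with h0 \<rho> have "norm (w z0) \<le> norm (w p)"
      by (meson mult_le_cancel_left_pos order_trans)
    hence wp: "norm (w p) > R" "norm (w p) > 0" using big by auto
    have "norm ((deriv ^^ 1) w p) \<le> fact 1 * (2 * norm (w p)) / d ^ 1"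
    proof (rule Cauchy_inequality)
      fix x assume x: "norm (p - x) = d"
      hence px: "dist p x = d" by (simp add: dist_norm)
      have dx: "dist z0 x \<le> \<rho> - d"
        using dist_triangle[of z0 x p] px by (simp add: d_def field_simps)
      have "d * norm (w x) \<le> h x"
        unfolding h_def using dx by (intro mult_right_mono) auto
      also have "\<dots> \<le> h p" using dx d by (intro p(2)) auto
      finally show "norm (w x) \<le> 2 * norm (w p)" using d by (simp add: hp)
    qed (use d cont in \<open>auto intro: holomorphic_on_subset[OF hol]\<close>)
    hence "a * (norm (w p))\<^sup>2 \<le> 2 * norm (w p) / d" using grow[OF wp(1)] by simp
    hence "a * h p \<le> 4" using d wp(2) by (simp add: hp field_simps power2_eq_square)
    moreover have "a * (\<rho> * norm (w z0)) \<le> a * h p"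
      using h0 a by (intro mult_left_mono) auto
    moreover have "a * (\<rho> * norm (w z0)) = 5" using a big by (simp add: \<rho>_def)
    ultimately show False by linarith
  qed
  hence "bounded (range w)" by (auto simp: bounded_iff)
  with hol show ?thesis
    using Liouville_theorem by (auto simp: constant_on_def)
qed

section \<open>Transferring identities between meromorphic functions\<close>

lemma analytic_at_eventually_eq_imp_eq:
  fixes F G :: "complex \<Rightarrow> complex"
  assumes "F analytic_on {z}" "G analytic_on {z}" "\<forall>\<^sub>F u in at z. F u = G u"
  shows "F z = G z" "\<forall>\<^sub>F u in nhds z. F u = G u"
proof -
  have "F \<midarrow>z\<rightarrow> F z" "G \<midarrow>z\<rightarrow> G z"
    using assms analytic_at_imp_isCont isContD by blast+
  moreover have "G \<midarrow>z\<rightarrow> F z" 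
    using calculation(1) assms(3) by (rule Lim_transform_eventually)
  ultimately show eq: "F z = G z"
    using tendsto_unique at_neq_bot by blast
  show "\<forall>\<^sub>F u in nhds z. F u = G u"
    using assms(3) eq by (simp add: eventually_nhds_conv_at)
qed

lemma analytic_at_eventually_eq_imp_deriv_eq:
  fixes F G :: "complex \<Rightarrow> complex"
  assumes "F analytic_on {z}" "G analytic_on {z}" "\<forall>\<^sub>F u in at z. F u = G u"
  shows "deriv F z = deriv G z"
  using analytic_at_eventually_eq_imp_eq[OF assms] by (intro deriv_cong_ev) auto

lemma eventually_cosparse_at:
  "eventually P (cosparse UNIV) \<Longrightarrow> eventually P (at (z::complex))"
  by (simp add: eventually_cosparse_open_eq)

lemma DERIV_analytic_at: "f analytic_on {z} \<Longrightarrow> (f has_field_derivative deriv f z) (at (z::complex))"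
  using analytic_on_imp_differentiable_at DERIV_deriv_iff_field_differentiable by blast

lemma filterlim_of_real_at_right_0: "filterlim complex_of_real (at 0) (at_right 0)"
proof (rule filterlim_atI)
  have "(complex_of_real \<longlongrightarrow> complex_of_real 0) (at_right 0)" by (intro tendsto_intros)
  thus "(complex_of_real \<longlongrightarrow> 0) (at_right 0)" by simp
  show "\<forall>\<^sub>F x in at_right 0. complex_of_real x \<noteq> 0"
    by (auto simp: eventually_at_right_less eventually_at_filter)
qed

lemma eventually_cosparse_imp_at_right_0:
  assumes "\<forall>\<^sub>\<approx>z\<in>UNIV. P z"
  shows "\<forall>\<^sub>F x in at_right (0::real). P (complex_of_real x)"
  using eventually_compose_filterlim[OF eventually_cosparse_at[OF assms] filterlim_of_real_at_right_0] .

text \<open>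
  The identity theorem along the positive real axis. A one-sided punctured neighbourhood of \<open>0\<close> is
  used because \<open>0\<close> itself may be a point where a meromorphic function carries a wrong value.
\<close>

lemma meromorphic_eq_0_at_right_0:
  assumes "F meromorphic_on UNIV" and "\<forall>\<^sub>F x in at_right (0::real). F (complex_of_real x) = 0"
  shows "\<forall>\<^sub>\<approx>z\<in>UNIV. F z = 0"
proof -
  have "\<not> (\<forall>\<^sub>\<approx>z\<in>UNIV. F z \<noteq> 0)"
  proof
    assume "\<forall>\<^sub>\<approx>z\<in>UNIV. F z \<noteq> 0"
    hence "\<forall>\<^sub>F x in at_right (0::real). F (complex_of_real x) \<noteq> 0"
      by (rule eventually_cosparse_imp_at_right_0)
    with assms(2) have "\<forall>\<^sub>F x in at_right (0::real). False"
      by eventually_elim simp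
    thus False by simp
  qed
  thus ?thesis
    using meromorphic_imp_constant_or_avoid[OF assms(1) open_UNIV connected_UNIV, of 0] by blast
qed

lemma complex_deriv_eq_real_deriv:
  fixes f :: "complex \<Rightarrow> complex" and g :: "real \<Rightarrow> real"
  assumes f: "f analytic_on {complex_of_real x}"
    and eq: "\<And>y. f (complex_of_real y) = complex_of_real (g y)"
    and g: "(g has_real_derivative D) (at x)"
  shows "deriv f (complex_of_real x) = complex_of_real D"
proof -
  have "((\<lambda>y. f (complex_of_real y)) has_vector_derivative deriv f (complex_of_real x)) (at x)"
    using DERIV_analytic_at[OF f] by (rule has_vector_derivative_real_field)
  moreover have "((\<lambda>y. complex_of_real (g y)) has_vector_derivative complex_of_real D) (at x)"
    using g by (intro has_vector_derivative_of_real)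
               (simp add: has_real_derivative_iff_has_vector_derivative)
  ultimately show ?thesis
    unfolding eq by (rule vector_derivative_unique_at)
qed

section \<open>The complex differential equation\<close>

text \<open>
  The pair \<open>s\<close>, \<open>v = 1 + sqrt (1 - k\<^sup>2 s\<^sup>2)\<close> on the complex plane. The square root is encoded
  by \<open>E1\<close>; \<open>E2\<close> is the differential equation of \<open>s\<close>. They can only be demanded off a sparse set,
  since a nicely meromorphic function has the value \<open>0\<close> at its poles.
\<close>

locale signature_four_sine =
  fixes s v :: "complex \<Rightarrow> complex" and k :: complex
  assumes s: "s nicely_meromorphic_on UNIV" and v: "v nicely_meromorphic_on UNIV"
    and k: "k \<noteq> 0"
    and E1: "\<forall>\<^sub>\<approx>z\<in>UNIV. (k * s z)\<^sup>2 = v z * (2 - v z)"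
    and E2: "\<forall>\<^sub>\<approx>z\<in>UNIV. v z * (deriv s z)\<^sup>2 = 2 * (1 - (s z)\<^sup>2) * (1 - (k * s z)\<^sup>2)"
begin

lemma deriv_relation:
  assumes "s analytic_on {z}" "v analytic_on {z}"
  shows "k\<^sup>2 * s z * deriv s z = (1 - v z) * deriv v z"
proof -
  have "deriv (\<lambda>z. (k * s z)\<^sup>2) z = deriv (\<lambda>z. v z * (2 - v z)) z"
    using assms eventually_cosparse_at[OF E1, of z]
    by (intro analytic_at_eventually_eq_imp_deriv_eq) (auto intro!: analytic_intros)
  moreover have "deriv (\<lambda>z. (k * s z)\<^sup>2) z = 2 * (k * s z) * (k * deriv s z)"
    by (rule DERIV_imp_deriv)
      (auto intro!: derivative_eq_intros DERIV_analytic_at assms)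
  moreover have "deriv (\<lambda>z. v z * (2 - v z)) z = deriv v z * (2 - v z) - v z * deriv v z"
    by (rule DERIV_imp_deriv)
      (auto intro!: derivative_eq_intros DERIV_analytic_at assms)
  ultimately have "2 * (k\<^sup>2 * s z * deriv s z) = 2 * ((1 - v z) * deriv v z)"
    by (simp add: algebra_simps power2_eq_square)
  thus ?thesis by simp
qed

lemma nonconstant_avoids:
  assumes nonconst: "\<not> v constant_on UNIV"
  shows "\<forall>\<^sub>\<approx>z\<in>UNIV. v z \<noteq> b"
  using nicely_meromorphic_imp_constant_or_avoid[OF v open_UNIV connected_UNIV, of b] nonconst
  by (auto simp: constant_on_def)

text \<open>
  Squaring \<open>deriv_relation\<close> and eliminating \<open>s\<close> and its derivative by \<open>E1\<close> and \<open>E2\<close> leaves the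
  common factor \<open>v (1 - v)\<^sup>2\<close>, which a nonconstant \<open>v\<close> allows to cancel off a sparse set;
  continuity gives the remaining points.
\<close>

lemma ode_v:
  assumes nonconst: "\<not> v constant_on UNIV" and an: "v analytic_on {z}"
  shows "(deriv v z)\<^sup>2 = 2 * (2 - v z) * ((v z)\<^sup>2 - 2 * v z + k\<^sup>2)"
proof -
  have mero: "s meromorphic_on UNIV" "v meromorphic_on UNIV"
    using s v by (auto simp: nicely_meromorphic_on_def)
  have "\<forall>\<^sub>\<approx>z\<in>UNIV. (deriv v z)\<^sup>2 = 2 * (2 - v z) * ((v z)\<^sup>2 - 2 * v z + k\<^sup>2)"
    using E1 E2 nonconstant_avoids[OF nonconst, of 0] nonconstant_avoids[OF nonconst, of 1]
      mero[THEN meromorphic_on_imp_analytic_cosparse]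
  proof eventually_elim
    case (elim z)
    define S V S' V' where "S = s z" "V = v z" "S' = deriv s z" "V' = deriv v z"
    note defs = this
    have D: "k\<^sup>2 * S * S' = (1 - V) * V'"
      using deriv_relation elim by (simp add: defs)
    have e1: "k\<^sup>2 * S\<^sup>2 = V * (2 - V)" and e2: "V * S'\<^sup>2 = 2 * (1 - S\<^sup>2) * (1 - k\<^sup>2 * S\<^sup>2)"
      using elim by (simp_all add: defs power_mult_distrib)
    have "V * (1 - V)\<^sup>2 * V'\<^sup>2 = V * (k\<^sup>2 * S * S')\<^sup>2"
      unfolding D by (simp add: power_mult_distrib)
    also have "\<dots> = (k\<^sup>2 * S\<^sup>2) * k\<^sup>2 * (V * S'\<^sup>2)"
      by (simp add: power_mult_distrib power2_eq_square)
    also have "\<dots> = (k\<^sup>2 * S\<^sup>2) * 2 * (k\<^sup>2 - k\<^sup>2 * S\<^sup>2) * (1 - k\<^sup>2 * S\<^sup>2)"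
      unfolding e2 by (simp add: algebra_simps)
    also have "\<dots> = V * (1 - V)\<^sup>2 * (2 * (2 - V) * (V\<^sup>2 - 2 * V + k\<^sup>2))"
      unfolding e1 by algebra
    finally show ?case using elim by (simp add: defs)
  qed
  thus ?thesis
    using an
    by (intro analytic_at_eventually_eq_imp_eq(1)[where z = z])
       (auto intro!: analytic_intros eventually_cosparse_at[where z=z])
qed

text \<open>
  At a zero of \<open>v\<close> the square of \<open>s\<close>, and hence \<open>s\<close>, tends to \<open>0\<close>. So \<open>s\<close> is holomorphic there, its
  square has a multiple zero, and \<open>v' = 0\<close> by \<open>deriv_relation\<close>; but the equation of \<open>v\<close> gives
  \<open>v'\<^sup>2 = 4 k\<^sup>2\<close>.
\<close>

lemma v_nonzero:
  assumes nonconst: "\<not> v constant_on UNIV" and an: "v analytic_on {z}"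
  shows "v z \<noteq> 0"
proof
  assume v0: "v z = 0"
  have "(\<lambda>u. v u * (2 - v u)) \<midarrow>z\<rightarrow> v z * (2 - v z)"
    using an by (intro tendsto_intros isContD analytic_at_imp_isCont)
  hence "(\<lambda>u. v u * (2 - v u)) \<midarrow>z\<rightarrow> 0" by (simp add: v0)
  moreover have "\<forall>\<^sub>F u in at z. v u * (2 - v u) = (k * s u)\<^sup>2"
    using eventually_cosparse_at[OF E1, of z] by eventually_elim (rule sym)
  ultimately have "(\<lambda>u. (k * s u)\<^sup>2) \<midarrow>z\<rightarrow> 0" by (rule Lim_transform_eventually)
  hence "(\<lambda>u. norm ((k * s u)\<^sup>2)) \<midarrow>z\<rightarrow> 0" by (rule tendsto_norm_zero)
  hence "(\<lambda>u. sqrt (norm ((k * s u)\<^sup>2))) \<midarrow>z\<rightarrow> sqrt 0" by (rule tendsto_real_sqrt)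
  hence "(\<lambda>u. norm (k * s u)) \<midarrow>z\<rightarrow> 0" by (simp add: norm_power)
  hence "(\<lambda>u. k * s u) \<midarrow>z\<rightarrow> 0" by (rule tendsto_norm_zero_cancel)
  hence "(\<lambda>u. inverse k * (k * s u)) \<midarrow>z\<rightarrow> inverse k * 0" by (rule tendsto_mult_left)
  hence lim: "s \<midarrow>z\<rightarrow> 0" using k by (simp flip: mult.assoc)
  hence "\<not> is_pole s z"
    using not_tendsto_and_filterlim_at_infinity[of "at z" s 0] by (auto simp: is_pole_def)
  hence s_an: "s analytic_on {z}" using nicely_meromorphic_on_imp_analytic_at s by blast
  hence "s z = 0"
    using lim LIM_unique analytic_at_imp_isCont isContD by blast
  with deriv_relation[OF s_an an] v0 have "deriv v z = 0" by simp
  with ode_v[OF assms] v0 k show False by simp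
qed

text \<open>The reciprocal \<open>w\<close> of \<open>v\<close> vanishes at the poles of \<open>v\<close> and has no poles of its own.\<close>

lemma v_constant: "v constant_on UNIV"
proof (rule ccontr)
  assume nonconst: "\<not> v constant_on UNIV"
  define w where "w = (\<lambda>z. inverse (v z))"
  have w: "w nicely_meromorphic_on UNIV"
    unfolding w_def by (intro meromorphic_intros v)
  have v_mero: "v meromorphic_on UNIV" using v by (auto simp: nicely_meromorphic_on_def)
  have w_an: "w analytic_on {z}" for z
  proof (rule nicely_meromorphic_on_imp_analytic_at[OF w])
    show "\<not> is_pole w z"
    proof
      assume "is_pole w z"
      hence "(\<lambda>u. inverse (w u)) \<midarrow>z\<rightarrow> 0"
        unfolding is_pole_def by (rule filterlim_compose[OF tendsto_inverse_0])
      hence lim: "v \<midarrow>z\<rightarrow> 0" by (simp add: w_def)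
      hence "\<not> is_pole v z"
        using not_tendsto_and_filterlim_at_infinity[of "at z" v 0] by (auto simp: is_pole_def)
      hence an: "v analytic_on {z}" using nicely_meromorphic_on_imp_analytic_at v by blast
      hence "v z = 0" using lim LIM_unique analytic_at_imp_isCont isContD by blast
      with v_nonzero[OF nonconst an] show False by simp
    qed
  qed auto
  have "\<forall>\<^sub>\<approx>z\<in>UNIV. (deriv w z)\<^sup>2 = 2 * w z * (2 * w z - 1) * (k\<^sup>2 * (w z)\<^sup>2 - 2 * w z + 1)"
    using meromorphic_on_imp_analytic_cosparse[OF v_mero]
  proof eventually_elim
    case (elim z)
    note nz = v_nonzero[OF nonconst elim]
    have "deriv w z = - (deriv v z / (v z)\<^sup>2)"
      unfolding w_def using nz
      by (intro DERIV_imp_deriv)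
         (auto intro!: derivative_eq_intros DERIV_analytic_at elim simp: field_simps power2_eq_square)
    hence "(deriv w z)\<^sup>2 = (deriv v z)\<^sup>2 / (v z)^4" by (simp add: power_divide)
    also have "\<dots> = 2 * ((2 - v z) / v z) * (((v z)\<^sup>2 - 2 * v z + k\<^sup>2) / (v z)\<^sup>2) / v z"
      unfolding ode_v[OF nonconst elim] by (simp add: power4_eq_xxxx power2_eq_square)
    also have "(2 - v z) / v z = 2 * w z - 1"
      using nz by (simp add: w_def diff_divide_distrib inverse_eq_divide)
    also have "((v z)\<^sup>2 - 2 * v z + k\<^sup>2) / (v z)\<^sup>2 = k\<^sup>2 * (w z)\<^sup>2 - 2 * w z + 1"
      using nz by (simp add: w_def diff_divide_distrib add_divide_distrib inverse_eq_divide 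
                     power2_eq_square)
    finally show ?case by (simp add: w_def divide_inverse mult_ac)
  qed
  hence ode: "(deriv w z)\<^sup>2 = 2 * w z * (2 * w z - 1) * (k\<^sup>2 * (w z)\<^sup>2 - 2 * w z + 1)" for z
    by (intro analytic_at_eventually_eq_imp_eq(1)[where z = z])
       (auto intro!: analytic_intros w_an eventually_cosparse_at[where z=z])
  have "w constant_on UNIV"
  proof (rule entire_deriv_ge_square_imp_constant)
    show "w holomorphic_on UNIV"
      using w_an analytic_on_analytic_at analytic_imp_holomorphic by blast
    show "norm k > 0" using k by simp
    \<comment> \<open>Beyond this radius the leading term \<open>k\<^sup>2 w\<^sup>2\<close> is at least twice the rest \<open>2 w - 1\<close>.\<close>
    fix z assume z: "norm (w z) > max 1 (6 / (norm k)\<^sup>2)"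
    define r where "r = norm (w z)"
    have r: "r > 1" "(norm k)\<^sup>2 * r > 6" using z k by (auto simp: r_def field_simps)
    have 1: "norm (2 * w z - 1) \<ge> r"
      using norm_triangle_ineq2[of "2 * w z" 1] r(1) by (simp add: r_def norm_mult)
    have "norm (k\<^sup>2 * (w z)\<^sup>2) \<le> norm (k\<^sup>2 * (w z)\<^sup>2 - 2 * w z + 1) + norm (2 * w z - 1)"
      using norm_triangle_ineq[of "k\<^sup>2 * (w z)\<^sup>2 - 2 * w z + 1" "2 * w z - 1"] by simp
    moreover have "norm (2 * w z - 1) \<le> 2 * r + 1"
      using norm_triangle_ineq4[of "2 * w z" 1] by (simp add: r_def norm_mult)
    moreover have "6 * r \<le> (norm k)\<^sup>2 * r * r" using r by (intro mult_right_mono) auto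
    ultimately have 2: "norm (k\<^sup>2 * (w z)\<^sup>2 - 2 * w z + 1) \<ge> (norm k)\<^sup>2 * r\<^sup>2 / 2"
      using r(1) by (simp add: norm_mult norm_power r_def power2_eq_square)
    have "(norm k * r\<^sup>2)\<^sup>2 = 2 * r * r * ((norm k)\<^sup>2 * r\<^sup>2 / 2)"
      by (simp add: power2_eq_square)
    also have "\<dots> \<le> 2 * r * norm (2 * w z - 1) * norm (k\<^sup>2 * (w z)\<^sup>2 - 2 * w z + 1)"
      using 1 2 r(1) by (intro mult_mono) auto
    also have "\<dots> = (norm (deriv w z))\<^sup>2"
      by (simp add: ode norm_mult r_def flip: norm_power)
    finally show "norm (deriv w z) \<ge> norm k * (norm (w z))\<^sup>2"
      unfolding r_def using norm_ge_zero power2_le_imp_le by blast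
  qed
  then obtain b where "\<And>z. inverse (v z) = b" by (auto simp: constant_on_def w_def)
  hence "v constant_on UNIV" unfolding constant_on_def by (metis inverse_inverse_eq)
  with nonconst show False by simp
qed

end

section \<open>No meromorphic extension\<close>

theorem theorem17:
  fixes \<kappa> :: real
  assumes "0 < \<kappa>" and "\<kappa> < 1"
  shows "\<not> (\<exists>f :: complex \<Rightarrow> complex. f meromorphic_on UNIV \<and>
           (\<forall>x::real. f (complex_of_real x) = complex_of_real (sin (phi \<kappa> x))))"
proof
  assume "\<exists>f :: complex \<Rightarrow> complex. f meromorphic_on UNIV \<and>
           (\<forall>x::real. f (complex_of_real x) = complex_of_real (sin (phi \<kappa> x)))"
  then obtain f where f: "f meromorphic_on UNIV"
    and f_eq: "\<And>x. f (complex_of_real x) = complex_of_real (sin (phi \<kappa> x))" by blast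
  define s where "s = remove_sings f"
  \<comment> \<open>The equation of the real function \<open>sin \<circ> phi \<kappa>\<close>, solved for \<open>1 + sqrt (1 - (\<kappa> s)\<^sup>2)\<close>.\<close>
  define V where "V = (\<lambda>z. 2 * (1 - (s z)\<^sup>2) * (1 - (\<kappa> * s z)\<^sup>2) / (deriv s z)\<^sup>2)"
  define v where "v = remove_sings V"
  define \<sigma> where "\<sigma> = (\<lambda>x. sin (phi \<kappa> x))"
  have s_mero: "s meromorphic_on UNIV"
    unfolding s_def by (intro meromorphic_intros f)
  have V_mero: "V meromorphic_on UNIV"
    unfolding V_def by (intro meromorphic_intros s_mero)
  have s_right: "\<forall>\<^sub>F x in at_right 0. s (complex_of_real x) = complex_of_real (\<sigma> x)"
    using eventually_cosparse_imp_at_right_0[OF eventually_remove_sings_eq[OF f]]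
    by eventually_elim (simp add: s_def f_eq \<sigma>_def)
  have phi_small: "\<bar>phi \<kappa> x\<bar> < 1" if "x \<in> {0<..<1}" for x
    using phi_Lipschitz[OF assms, of x 0] that by (simp add: phi_0[OF assms])
  have unit: "\<forall>\<^sub>F x in at_right (0::real). x \<in> {0<..<1}"
    by (rule eventually_at_right_real) simp
  have real_eqs: "\<forall>\<^sub>F x in at_right 0.
      (\<kappa> * s (complex_of_real x))\<^sup>2 = V (complex_of_real x) * (2 - V (complex_of_real x)) \<and>
      V (complex_of_real x) * (deriv s (complex_of_real x))\<^sup>2 =
        2 * (1 - (s (complex_of_real x))\<^sup>2) * (1 - (\<kappa> * s (complex_of_real x))\<^sup>2)"
    using eventually_cosparse_imp_at_right_0[OF meromorphic_on_imp_analytic_cosparse[OF f]]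
      s_right unit
  proof eventually_elim
    case (elim x)
    define c where "c = sqrt (1 - (\<kappa> * \<sigma> x)\<^sup>2)"
    have \<sigma>1: "(\<kappa> * \<sigma> x)\<^sup>2 < 1"
      using hyp_arg(2)[OF assms] by (simp add: \<sigma>_def power_mult_distrib)
    hence c: "c > 0" "c\<^sup>2 = 1 - (\<kappa> * \<sigma> x)\<^sup>2" by (simp_all add: c_def)
    have "cos (phi \<kappa> x) > 0"
      using phi_small[OF elim(3)] pi_gt3 by (intro cos_gt_zero_pi) auto
    hence \<sigma>2: "1 - (\<sigma> x)\<^sup>2 > 0"
      unfolding \<sigma>_def by (simp flip: cos_squared_eq)
    obtain D where D: "(\<sigma> has_real_derivative D) (at x)"
      "(1 + c) * D\<^sup>2 = 2 * (1 - (\<sigma> x)\<^sup>2) * (1 - (\<kappa> * \<sigma> x)\<^sup>2)"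
      using DERIV_sin_phi[OF assms] unfolding \<sigma>_def c_def by blast
    have "D \<noteq> 0" using D(2) \<sigma>1 \<sigma>2 by auto
    have "deriv s (complex_of_real x) = complex_of_real D"
      unfolding s_def deriv_remove_sings_at_analytic[OF elim(1)]
      using elim(1) f_eq D(1) unfolding \<sigma>_def by (rule complex_deriv_eq_real_deriv)
    note sx = this elim(2)
    have "V (complex_of_real x) = 
            complex_of_real (2 * (1 - (\<sigma> x)\<^sup>2) * (1 - (\<kappa> * \<sigma> x)\<^sup>2) / D\<^sup>2)"
      unfolding V_def sx by simp
    also have "\<dots> = complex_of_real (1 + c)"
      unfolding D(2)[symmetric] using \<open>D \<noteq> 0\<close> by simp
    finally have Vx: "V (complex_of_real x) = complex_of_real (1 + c)" .
    have "(\<kappa> * \<sigma> x)\<^sup>2 = (1 + c) * (2 - (1 + c))"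
      using c(2) by (simp add: algebra_simps power2_eq_square)
    hence "complex_of_real ((\<kappa> * \<sigma> x)\<^sup>2) = complex_of_real ((1 + c) * (2 - (1 + c)))"
      by (simp only:)
    moreover have "complex_of_real ((1 + c) * D\<^sup>2) =
                     complex_of_real (2 * (1 - (\<sigma> x)\<^sup>2) * (1 - (\<kappa> * \<sigma> x)\<^sup>2))"
      by (simp only: D(2))
    ultimately show ?case unfolding Vx sx by simp
  qed
  have "\<forall>\<^sub>\<approx>z\<in>UNIV. (\<kappa> * s z)\<^sup>2 - V z * (2 - V z) = 0"
  proof (rule meromorphic_eq_0_at_right_0)
    show "\<forall>\<^sub>F x in at_right 0. (\<kappa> * s (complex_of_real x))\<^sup>2 -
        V (complex_of_real x) * (2 - V (complex_of_real x)) = 0"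
      using real_eqs by eventually_elim simp
  qed (intro meromorphic_intros s_mero V_mero)
  hence E1: "\<forall>\<^sub>\<approx>z\<in>UNIV. (\<kappa> * s z)\<^sup>2 = v z * (2 - v z)"
    using eventually_remove_sings_eq[OF V_mero] by eventually_elim (simp add: v_def)
  have "\<forall>\<^sub>\<approx>z\<in>UNIV. V z * (deriv s z)\<^sup>2 - 2 * (1 - (s z)\<^sup>2) * (1 - (\<kappa> * s z)\<^sup>2) = 0"
  proof (rule meromorphic_eq_0_at_right_0)
    show "\<forall>\<^sub>F x in at_right 0. V (complex_of_real x) * (deriv s (complex_of_real x))\<^sup>2 -
        2 * (1 - (s (complex_of_real x))\<^sup>2) * (1 - (\<kappa> * s (complex_of_real x))\<^sup>2) = 0"
      using real_eqs by eventually_elim simp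
  qed (intro meromorphic_intros s_mero V_mero)
  hence E2: "\<forall>\<^sub>\<approx>z\<in>UNIV. v z * (deriv s z)\<^sup>2 = 2 * (1 - (s z)\<^sup>2) * (1 - (\<kappa> * s z)\<^sup>2)"
    using eventually_remove_sings_eq[OF V_mero] by eventually_elim (simp add: v_def)
  interpret signature_four_sine s v "complex_of_real \<kappa>"
    by standard
       (use assms E1 E2 f V_mero in \<open>auto simp: s_def v_def intro!: remove_sings_nicely_meromorphic\<close>)
  obtain b where b: "\<And>z. v z = b" using v_constant by (auto simp: constant_on_def)
  \<comment> \<open>So \<open>\<kappa>\<^sup>2 sin\<^sup>2 (phi \<kappa> x)\<close> is constant for small positive \<open>x\<close>; its limit at \<open>0\<close> shows that the
    constant is \<open>0\<close>.\<close>
  have const: "\<forall>\<^sub>F x in at_right 0. complex_of_real ((\<kappa> * \<sigma> x)\<^sup>2) = b * (2 - b)"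
    using eventually_cosparse_imp_at_right_0[OF E1] s_right by eventually_elim (simp add: b)
  have "isCont (\<lambda>x. complex_of_real ((\<kappa> * \<sigma> x)\<^sup>2)) 0"
    unfolding \<sigma>_def by (intro continuous_intros isCont_phi[OF assms])
  hence "((\<lambda>x. complex_of_real ((\<kappa> * \<sigma> x)\<^sup>2)) \<longlongrightarrow> complex_of_real ((\<kappa> * \<sigma> 0)\<^sup>2)) (at_right 0)"
    unfolding isCont_def by (rule tendsto_within_subset) simp
  moreover have "\<sigma> 0 = 0" by (simp add: \<sigma>_def phi_0[OF assms])
  ultimately have "((\<lambda>x. complex_of_real ((\<kappa> * \<sigma> x)\<^sup>2)) \<longlongrightarrow> 0) (at_right 0)"
    by (simp only: mult_zero_right power_zero_numeral of_real_0)
  hence "((\<lambda>_. b * (2 - b)) \<longlongrightarrow> 0) (at_right (0::real))"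
    using const by (rule Lim_transform_eventually)
  hence b0: "b * (2 - b) = 0"
    by (rule tendsto_unique[OF trivial_limit_at_right_real tendsto_const])
  have "\<forall>\<^sub>F x in at_right (0::real). False"
    using const unit
  proof eventually_elim
    case (elim x)
    have "complex_of_real ((\<kappa> * \<sigma> x)\<^sup>2) = 0" using elim(1) unfolding b0 .
    hence "sin (phi \<kappa> x) = 0" using assms(1) by (simp add: \<sigma>_def)
    hence "phi \<kappa> x = 0"
      using phi_small[OF elim(2)] pi_gt3 sin_eq_0_pi[of "phi \<kappa> x"] by linarith
    thus False using elim(2) phi_eq_0_iff[OF assms] by simp
  qed
  thus False by simp
qed

end
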